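(* Let $\sigma\in\mathcal{S}_k$ and $\tau\in\mathcal{S}_n$ with $\sigma\le\tau$, and fix an occurrence $\langle\sigma\rangle$ of $\sigma$ in $\tau$. The occurrence poset $[\langle\sigma\rangle,\tau]$ is a boolean algebra if and only if the pair $(\langle\sigma\rangle,\tau)$ is separated. In this case $\mu(\langle\sigma\rangle,\tau)=(-1)^{n-k}$.
   Context: Permutations are in one-line notation. $\tau$ contains $\sigma$ ($\sigma\le\tau$) if some subsequence $\tau(i_1)\cdots\tau(i_k)$ ($i_1<\dots<i_k$) is order isomorphic to $\sigma$ (letters in the same relative order of size); such a subsequence is an occurrence of $\sigma$ in $\tau$. A region of $\tau$ (with respect to $\langle\sigma\rangle$) is a maximal consecutive substring of $\tau$ consisting of letters not in $\langle\sigma\rangle$. The pair $(\langle\sigma\rangle,\tau)$ is separated if for all letters $x<y$ lying in the same region there is a letter $c$ of $\langle\sigma\rangle$ with $x<c<y$. Occurrence poset: let $C$ be the set of letters of $\tau$ not in $\langle\sigma\rangle$. For $S\subseteq C$, let $\langle\sigma\rangle+S$ denote the subsequence of $\tau$ formed by the letters of $\langle\sigma\rangle$ and $S$, recorded as its standard form (order-isomorphic permutation of $\{1,\dots,k+|S|\}$) together with the set of positions of the letters of $\langle\sigma\rangle$; two subsets giving the same standard form and same marked positions give the same element. $[\langle\sigma\rangle,\tau]$ is the set of these elements, ordered by: $\rho\le\pi$ iff $\rho$ is obtained from $\pi$ by deleting letters of $\pi$ not in the marked occurrence (equivalently $\rho=\langle\sigma\rangle+S$, $\pi=\langle\sigma\rangle+S'$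 with $S\subseteq S'$). It has minimum $\langle\sigma\rangle$ and maximum $\tau$, and $\mu(\langle\sigma\rangle,\tau)$ denotes its Möbius function between them ($\mu(s,s)=1$, $\mu(s,t)=-\sum_{s\le x<t}\mu(s,x)$). Boolean algebra means isomorphic to the lattice of all subsets of a finite set. *)

theory Defs
  imports "HOL-Combinatorics.Multiset_Permutations" "HOL-Library.Sublist"
begin

text \<open>A permutation of size n is its one-line notation, an element of
  \<^term>\<open>permutations_of_set {1..n::nat}\<close>. Since its letters are distinct, a subsequence
  (as a list) determines the positions it occupies.\<close>

definition order_isomorphic :: "nat list \<Rightarrow> nat list \<Rightarrow> bool" where
  "order_isomorphic xs ys \<longleftrightarrow> length xs = length ys \<and>
     (\<forall>i<length xs. \<forall>j<length xs. xs ! i < xs ! j \<longleftrightarrow> ys ! i < ys ! j)"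

definition is_occurrence :: "nat list \<Rightarrow> nat list \<Rightarrow> nat list \<Rightarrow> bool" where
  "is_occurrence occ \<sigma> \<tau> \<longleftrightarrow> subseq occ \<tau> \<and> order_isomorphic occ \<sigma>"

definition contained_in :: "nat list \<Rightarrow> nat list \<Rightarrow> bool" where
  "contained_in \<sigma> \<tau> \<longleftrightarrow> (\<exists>occ. is_occurrence occ \<sigma> \<tau>)"

definition is_region :: "nat list \<Rightarrow> nat list \<Rightarrow> nat list \<Rightarrow> bool" where
  "is_region occ \<tau> r \<longleftrightarrow> sublist r \<tau> \<and> set r \<inter> set occ = {} \<and>
     (\<forall>r'. sublist r' \<tau> \<and> set r' \<inter> set occ = {} \<and> sublist r r' \<longrightarrow> r' = r)"

definition separated :: "nat list \<Rightarrow> nat list \<Rightarrow> bool" where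
  "separated occ \<tau> \<longleftrightarrow>
     (\<forall>r. is_region occ \<tau> r \<longrightarrow>
        (\<forall>x\<in>set r. \<forall>y\<in>set r. x < y \<longrightarrow> (\<exists>c\<in>set occ. x < c \<and> c < y)))"

text \<open>Replace each letter by its rank; see \<open>standard_form_iff\<close> below.\<close>

definition standard_form :: "nat list \<Rightarrow> nat list" where
  "standard_form w = map (\<lambda>x. card {y \<in> set w. y \<le> x}) w"

text \<open>The word \<open>w\<close> up to order isomorphism, with the (0-based) positions of its letters in
  \<open>L\<close> marked.\<close>

definition marked_form :: "nat list \<Rightarrow> nat set \<Rightarrow> nat list \<times> nat set" where
  "marked_form w L = (standard_form w, {i. i < length w \<and> w ! i \<in> L})"

definition marked_letters :: "nat list \<times> nat set \<Rightarrow> nat set" where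
  "marked_letters \<pi> = (\<lambda>i. fst \<pi> ! i) ` snd \<pi>"

definition complement_letters :: "nat list \<Rightarrow> nat list \<Rightarrow> nat set" where
  "complement_letters occ \<tau> = set \<tau> - set occ"

definition occ_plus :: "nat list \<Rightarrow> nat list \<Rightarrow> nat set \<Rightarrow> nat list \<times> nat set" where
  "occ_plus occ \<tau> S = marked_form (filter (\<lambda>x. x \<in> set occ \<union> S) \<tau>) (set occ)"

definition obtained_by_deletion :: "nat list \<times> nat set \<Rightarrow> nat list \<times> nat set \<Rightarrow> bool" where
  "obtained_by_deletion \<rho> \<pi> \<longleftrightarrow>
     (\<exists>D. D \<subseteq> set (fst \<pi>) - marked_letters \<pi> \<and>
        \<rho> = marked_form (filter (\<lambda>x. x \<notin> D) (fst \<pi>)) (marked_letters \<pi>))"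

definition occ_poset :: "nat list \<Rightarrow> nat list \<Rightarrow> (nat list \<times> nat set) set" where
  "occ_poset occ \<tau> = occ_plus occ \<tau> ` Pow (complement_letters occ \<tau>)"

definition occ_order :: "nat list \<Rightarrow> nat list \<Rightarrow> (nat list \<times> nat set) rel" where
  "occ_order occ \<tau> =
     {(\<rho>, \<pi>). \<rho> \<in> occ_poset occ \<tau> \<and> \<pi> \<in> occ_poset occ \<tau> \<and> obtained_by_deletion \<rho> \<pi>}"

abbreviation occ_bot :: "nat list \<Rightarrow> nat list \<Rightarrow> nat list \<times> nat set" where
  "occ_bot occ \<tau> \<equiv> occ_plus occ \<tau> {}"

abbreviation occ_top :: "nat list \<Rightarrow> nat list \<Rightarrow> nat list \<times> nat set" where
  "occ_top occ \<tau> \<equiv> occ_plus occ \<tau> (complement_letters occ \<tau>)"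

text \<open>Taking \<open>B\<close> to be a set of naturals is no restriction, as every finite set is
  equipotent to one.\<close>

definition boolean_algebra_on :: "'a set \<Rightarrow> 'a rel \<Rightarrow> bool" where
  "boolean_algebra_on A r \<longleftrightarrow>
     (\<exists>(B :: nat set) f. finite B \<and> bij_betw f A (Pow B) \<and>
        (\<forall>x\<in>A. \<forall>y\<in>A. (x, y) \<in> r \<longleftrightarrow> f x \<subseteq> f y))"

text \<open>The Moebius function of a finite poset; the first guard only serves termination.\<close>

function moebius :: "'a set \<Rightarrow> 'a rel \<Rightarrow> 'a \<Rightarrow> 'a \<Rightarrow> int" where
  "moebius A r s t =
     (if \<not> (finite A \<and> partial_order_on A r) then 0
      else if (s, t) \<notin> r then 0
      else if s = t then 1
      else - (\<Sum>x\<in>{x \<in> A. (s, x) \<in> r \<and> (x, t) \<in> r \<and> x \<noteq> t}. moebius A r s x))"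
  by pat_completeness auto
termination
proof (relation "measure (\<lambda>(A, r, s, t). card {x \<in> A. (x, t) \<in> r})", goal_cases)
  case 1
  show ?case by simp
next
  case (2 A r s t x)
  then have po: "partial_order_on A r" and fin: "finite A" by auto
  have tr: "trans r" and as: "antisym r" and rf: "refl_on A r" and sub: "r \<subseteq> A \<times> A"
    using po by (auto simp: partial_order_on_def preorder_on_def)
  have xt: "(x, t) \<in> r" "x \<noteq> t" using 2 by auto
  have t: "t \<in> A" "(t, t) \<in> r" using xt sub rf by (auto simp: refl_on_def)
  have "{y \<in> A. (y, x) \<in> r} \<subset> {y \<in> A. (y, t) \<in> r}"
    using xt t tr as by (auto dest: transD antisymD)
  then show ?case using fin by (auto intro!: psubset_card_mono)
qed

declare moebius.simps [simp del]


lemma rank_less_iff: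
  assumes "finite A" "x \<in> A" "y \<in> A"
  shows "card {z \<in> A. z \<le> x} < card {z \<in> A. z \<le> y} \<longleftrightarrow> x < (y::nat)"
proof -
  have *: "card {z \<in> A. z \<le> a} < card {z \<in> A. z \<le> b}" if "a < b" "b \<in> A" for a b :: nat
  proof (rule psubset_card_mono)
    have "b \<in> {z \<in> A. z \<le> b}" "b \<notin> {z \<in> A. z \<le> a}" using that by auto
    moreover have "{z \<in> A. z \<le> a} \<subseteq> {z \<in> A. z \<le> b}" using that by auto
    ultimately show "{z \<in> A. z \<le> a} \<subset> {z \<in> A. z \<le> b}" by blast
  qed (use assms in simp)
  show ?thesis using *[of x y] *[of y x] assms by (cases x y rule: linorder_cases) auto
qed

lemma rank_map:
  assumes f: "\<And>x y. x \<in> A \<Longrightarrow> y \<in> A \<Longrightarrow> f x < f y \<longleftrightarrow> x < (y::nat)"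
    and w: "set w \<subseteq> A"
  shows "standard_form (map f w) = standard_form w"
proof -
  have inj: "inj_on f A" 
    by (rule inj_onI) (metis f nat_neq_iff)
  have "card {y \<in> set (map f w). y \<le> f x} = card {y \<in> set w. y \<le> x}" if "x \<in> set w" for x
  proof -
    have "{y \<in> set (map f w). y \<le> (f x::nat)} = f ` {y \<in> set w. y \<le> x}"
      using that w f by (auto simp: not_less[symmetric] subset_iff)
    moreover have "inj_on f {y \<in> set w. y \<le> x}"
      by (rule inj_on_subset[OF inj]) (use w in auto)
    ultimately show ?thesis by (simp add: card_image)
  qed
  then show ?thesis by (simp add: standard_form_def)
qed

lemma marked_form_map:
  assumes f: "\<And>x y. x \<in> A \<Longrightarrow> y \<in> A \<Longrightarrow> f x < f y \<longleftrightarrow> x < (y::nat)"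
    and w: "set w \<subseteq> A" "L \<subseteq> A"
  shows "marked_form (map f w) (f ` L) = marked_form w L"
proof -
  have inj: "inj_on f A" 
    by (rule inj_onI) (metis f nat_neq_iff)
  have "f (w ! i) \<in> f ` L \<longleftrightarrow> w ! i \<in> L" if "i < length w" for i
    using that w inj nth_mem[OF that] by (meson inj_on_image_mem_iff subsetD)
  then have "{i. i < length (map f w) \<and> map f w ! i \<in> f ` L} = {i. i < length w \<and> w ! i \<in> L}"
    by (intro Collect_cong) (metis length_map nth_map)
  then show ?thesis
    using rank_map[OF f w(1)] by (simp only: marked_form_def)
qed

lemma length_standard_form [simp]: "length (standard_form w) = length w"
  by (simp add: standard_form_def)

lemma standard_form_permutation:
  assumes "distinct w"
  shows "standard_form w \<in> permutations_of_set {1..length w}"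
proof -
  let ?f = "\<lambda>x. card {y \<in> set w. y \<le> x}"
  have inj: "inj_on ?f (set w)"
    by (rule inj_onI) (metis rank_less_iff[of "set w"] List.finite_set nat_neq_iff)
  have "?f x \<in> {1..length w}" if "x \<in> set w" for x
  proof -
    have "?f x \<le> card (set w)" by (rule card_mono) auto
    moreover have "{y \<in> set w. y \<le> x} \<noteq> {}" using that by auto
    then have "?f x > 0" by (simp add: card_gt_0_iff)
    ultimately show ?thesis using assms by (simp add: distinct_card)
  qed
  then have "?f ` set w \<subseteq> {1..length w}" by auto
  moreover have "card (?f ` set w) = length w"
    using assms inj by (simp add: card_image distinct_card)
  ultimately have "?f ` set w = {1..length w}"
    by (intro card_subset_eq) auto
  then show ?thesis
    using assms inj by (simp add: permutations_of_set_def standard_form_def distinct_map)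
qed

lemma order_isomorphic_standard_form: "order_isomorphic w (standard_form w)"
  by (auto simp: order_isomorphic_def standard_form_def rank_less_iff)

lemma standard_form_id:
  assumes "w \<in> permutations_of_set {1..n}"
  shows "standard_form w = w"
proof -
  have "{y. Suc 0 \<le> y \<and> y \<le> n \<and> y \<le> x} = {1..x}" if "x \<le> n" for x
    using that by auto
  then show ?thesis
    using assms by (auto simp: permutations_of_set_def standard_form_def intro!: map_idI)
qed

lemma standard_form_cong:
  assumes "order_isomorphic v w" "distinct v"
  shows "standard_form v = standard_form w"
proof (rule nth_equalityI)
  show l: "length (standard_form v) = length (standard_form w)"
    using assms by (simp add: order_isomorphic_def)
  fix i assume "i < length (standard_form v)"
  then have i: "i < length v" "i < length w" using l by simp_all
  have len: "length v = length w" using l by simp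
  have lt: "v ! j < v ! k \<longleftrightarrow> w ! j < w ! k" if "j < length v" "k < length v" for j k
    using assms that by (auto simp: order_isomorphic_def)
  have dw: "distinct w"
    unfolding distinct_conv_nth using assms(2) lt len
    by (metis distinct_conv_nth nat_neq_iff)
  have "card {y \<in> set u. y \<le> u ! i} = card {j. j < length u \<and> u ! j \<le> u ! i}"
    if "distinct u" for u :: "nat list"
  proof -
    have "{y \<in> set u. y \<le> u ! i} = (!) u ` {j. j < length u \<and> u ! j \<le> u ! i}"
      by (auto simp: in_set_conv_nth)
    moreover have "inj_on ((!) u) {j. j < length u \<and> u ! j \<le> u ! i}"
      using that by (auto simp: inj_on_def nth_eq_iff_index_eq)
    ultimately show ?thesis by (simp add: card_image)
  qed
  moreover have "{j. j < length v \<and> v ! j \<le> v ! i} = {j. j < length w \<and> w ! j \<le> w ! i}"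
    using lt[OF i(1)] len by (auto simp: not_less[symmetric])
  ultimately show "standard_form v ! i = standard_form w ! i"
    using i assms(2) dw by (simp add: standard_form_def)
qed

lemma standard_form_iff:
  assumes "distinct w"
  shows "p = standard_form w \<longleftrightarrow>
    p \<in> permutations_of_set {1..length w} \<and> order_isomorphic w p"
proof
  assume "p = standard_form w"
  then show "p \<in> permutations_of_set {1..length w} \<and> order_isomorphic w p"
    using standard_form_permutation[OF assms] order_isomorphic_standard_form by simp
next
  assume p: "p \<in> permutations_of_set {1..length w} \<and> order_isomorphic w p"
  then have "standard_form w = standard_form p" using assms by (intro standard_form_cong) auto
  also have "\<dots> = p" using p standard_form_id by blast
  finally show "p = standard_form w" by simp
qed

lemma deletion_marked_form:
  assumes "distinct w" "L \<subseteq> set w"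
  shows "obtained_by_deletion \<rho> (marked_form w L) \<longleftrightarrow>
    (\<exists>D. D \<subseteq> set w - L \<and> \<rho> = marked_form (filter (\<lambda>x. x \<notin> D) w) L)"
proof -
  define f where "f = (\<lambda>x. card {y \<in> set w. y \<le> x})"
  have f: "f x < f y \<longleftrightarrow> x < y" if "x \<in> set w" "y \<in> set w" for x y
    using that by (simp add: f_def rank_less_iff)
  have inj: "inj_on f (set w)" 
    by (rule inj_onI) (metis f nat_neq_iff)
  have fst: "fst (marked_form w L) = map f w"
    by (simp add: marked_form_def standard_form_def f_def)
  have ml: "marked_letters (marked_form w L) = f ` L"
  proof -
    have "marked_letters (marked_form w L) = (\<lambda>i. f (w ! i)) ` {i. i < length w \<and> w ! i \<in> L}"
      unfolding marked_letters_def fst by (auto simp: marked_form_def)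
    also have "\<dots> = f ` L"
      using assms(2) by (fastforce simp: image_iff in_set_conv_nth subset_iff)
    finally show ?thesis .
  qed
  have sub: "f ` set w - f ` L = f ` (set w - L)"
    using inj assms(2) by (simp add: inj_on_image_set_diff)
  have flt: "marked_form (filter (\<lambda>x. x \<notin> f ` D) (map f w)) (f ` L)
      = marked_form (filter (\<lambda>x. x \<notin> D) w) L" if D: "D \<subseteq> set w - L" for D
  proof -
    have "f x \<in> f ` D \<longleftrightarrow> x \<in> D" if "x \<in> set w" for x
      using inj that D by (meson Diff_subset inj_on_image_mem_iff order_trans)
    then have "filter (\<lambda>x. x \<notin> f ` D) (map f w) = map f (filter (\<lambda>x. x \<notin> D) w)"
      by (auto simp: filter_map o_def cong: filter_cong)
    then show ?thesis
      using marked_form_map[where A = "set w", OF f, of "filter (\<lambda>x. x \<notin> D) w" L] assms(2)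
      by auto
  qed
  have "obtained_by_deletion \<rho> (marked_form w L) \<longleftrightarrow>
    (\<exists>E. E \<subseteq> f ` (set w - L) \<and>
      \<rho> = marked_form (filter (\<lambda>x. x \<notin> E) (map f w)) (f ` L))"
    unfolding obtained_by_deletion_def fst ml list.set_map sub ..
  also have "\<dots> \<longleftrightarrow> (\<exists>D. D \<subseteq> set w - L \<and>
      \<rho> = marked_form (filter (\<lambda>x. x \<notin> f ` D) (map f w)) (f ` L))"
    unfolding subset_image_iff by blast
  also have "\<dots> \<longleftrightarrow> (\<exists>D. D \<subseteq> set w - L \<and> \<rho> = marked_form (filter (\<lambda>x. x \<notin> D) w) L)"
    using flt by metis
  finally show ?thesis .
qed

lemma deletion_occ_plus:
  assumes "distinct \<tau>" "set occ \<subseteq> set \<tau>" "S' \<subseteq> complement_letters occ \<tau>"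
  shows "obtained_by_deletion \<rho> (occ_plus occ \<tau> S') \<longleftrightarrow> (\<exists>S\<subseteq>S'. \<rho> = occ_plus occ \<tau> S)"
proof -
  let ?w = "filter (\<lambda>x. x \<in> set occ \<union> S') \<tau>"
  have sw: "set ?w = set occ \<union> S'" using assms by (auto simp: complement_letters_def)
  have dj: "set occ \<inter> S' = {}" using assms by (auto simp: complement_letters_def)
  have fl: "filter (\<lambda>x. x \<notin> D) ?w = filter (\<lambda>x. x \<in> set occ \<union> (S' - D)) \<tau>"
    if "D \<subseteq> S'" for D
    using that dj by (auto intro!: filter_cong)
  have "obtained_by_deletion \<rho> (occ_plus occ \<tau> S') \<longleftrightarrow>
      (\<exists>D. D \<subseteq> set ?w - set occ \<and> \<rho> = marked_form (filter (\<lambda>x. x \<notin> D) ?w) (set occ))"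
    unfolding occ_plus_def
    by (rule deletion_marked_form) (use assms sw in auto)
  also have "set ?w - set occ = S'" using sw dj by blast
  also have "(\<exists>D. D \<subseteq> S' \<and> \<rho> = marked_form (filter (\<lambda>x. x \<notin> D) ?w) (set occ)) \<longleftrightarrow>
      (\<exists>D. D \<subseteq> S' \<and> \<rho> = occ_plus occ \<tau> (S' - D))"
    unfolding occ_plus_def using fl by metis
  also have "\<dots> \<longleftrightarrow> (\<exists>S\<subseteq>S'. \<rho> = occ_plus occ \<tau> S)"
    by (metis Diff_subset double_diff subset_refl)
  finally show ?thesis .
qed

lemma occ_order_iff:
  assumes "distinct \<tau>" "set occ \<subseteq> set \<tau>"
  shows "(\<rho>, \<pi>) \<in> occ_order occ \<tau> \<longleftrightarrow>
    (\<exists>S S'. S \<subseteq> S' \<and> S' \<subseteq> complement_letters occ \<tau> \<and>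
       \<rho> = occ_plus occ \<tau> S \<and> \<pi> = occ_plus occ \<tau> S')" (is "?l \<longleftrightarrow> ?r")
proof
  assume ?l
  then obtain S' where S': "S' \<subseteq> complement_letters occ \<tau>" "\<pi> = occ_plus occ \<tau> S'"
    "obtained_by_deletion \<rho> (occ_plus occ \<tau> S')"
    by (auto simp: occ_order_def occ_poset_def)
  then obtain S where "S \<subseteq> S'" "\<rho> = occ_plus occ \<tau> S"
    using deletion_occ_plus[OF assms S'(1), of \<rho>] by auto
  with S' show ?r by metis
next
  assume ?r
  then obtain S S' where S: "S \<subseteq> S'" "S' \<subseteq> complement_letters occ \<tau>"
    "\<rho> = occ_plus occ \<tau> S" "\<pi> = occ_plus occ \<tau> S'"
    by metis
  then have "obtained_by_deletion \<rho> \<pi>"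
    using deletion_occ_plus[OF assms S(2), of \<rho>] by auto
  moreover have "\<rho> \<in> occ_poset occ \<tau>" "\<pi> \<in> occ_poset occ \<tau>"
    using S by (auto simp: occ_poset_def)
  ultimately show ?l by (simp add: occ_order_def)
qed

lemma finite_occ_poset: "finite (occ_poset occ \<tau>)"
  by (simp add: occ_poset_def complement_letters_def)

lemma partial_order_occ_order:
  assumes "distinct \<tau>" "set occ \<subseteq> set \<tau>"
  shows "partial_order_on (occ_poset occ \<tau>) (occ_order occ \<tau>)"
proof -
  let ?C = "complement_letters occ \<tau>"
  have len: "length (fst (occ_plus occ \<tau> S)) = card (set occ) + card S" if "S \<subseteq> ?C" for S
  proof -
    have "length (fst (occ_plus occ \<tau> S)) = card (set (filter (\<lambda>x. x \<in> set occ \<union> S) \<tau>))"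
      unfolding distinct_card[OF distinct_filter[OF assms(1)]]
      by (simp add: occ_plus_def marked_form_def)
    also have "set (filter (\<lambda>x. x \<in> set occ \<union> S) \<tau>) = set occ \<union> S"
      using that assms by (auto simp: complement_letters_def)
    also have "card \<dots> = card (set occ) + card S"
      by (rule card_Un_disjoint)
         (use that in \<open>auto simp: complement_letters_def intro: finite_subset\<close>)
    finally show ?thesis .
  qed
  have "refl_on (occ_poset occ \<tau>) (occ_order occ \<tau>)"
    by (auto simp: refl_on_def occ_poset_def occ_order_iff[OF assms])
  moreover have "trans (occ_order occ \<tau>)"
  proof (rule transI)
    fix x y z assume xy: "(x, y) \<in> occ_order occ \<tau>" and yz: "(y, z) \<in> occ_order occ \<tau>"
    from yz obtain S' S'' where 1: "S' \<subseteq> S''" "S'' \<subseteq> ?C" "y = occ_plus occ \<tau> S'"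
      "z = occ_plus occ \<tau> S''" by (auto simp: occ_order_iff[OF assms])
    from xy 1 obtain S where "S \<subseteq> S'" "x = occ_plus occ \<tau> S"
      using deletion_occ_plus[OF assms, of S'] by (auto simp: occ_order_def)
    then show "(x, z) \<in> occ_order occ \<tau>"
      using 1 unfolding occ_order_iff[OF assms] by blast
  qed
  moreover have "antisym (occ_order occ \<tau>)"
  proof (rule antisymI)
    fix x y assume xy: "(x, y) \<in> occ_order occ \<tau>" and yx: "(y, x) \<in> occ_order occ \<tau>"
    from xy obtain S S' where 1: "S \<subseteq> S'" "S' \<subseteq> ?C" "x = occ_plus occ \<tau> S"
      "y = occ_plus occ \<tau> S'" by (auto simp: occ_order_iff[OF assms])
    from yx obtain T T' where 2: "T \<subseteq> T'" "T' \<subseteq> ?C" "y = occ_plus occ \<tau> T"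
      "x = occ_plus occ \<tau> T'" by (auto simp: occ_order_iff[OF assms])
    have fin: "finite ?C" by (simp add: complement_letters_def)
    have "card T \<le> card T'" using 2 fin by (meson card_mono finite_subset)
    then have "card S' \<le> card S"
      using len[of S] len[of S'] len[of T] len[of T'] 1 2 by auto
    then have "S = S'" using 1 fin by (meson card_seteq finite_subset)
    then show "x = y" using 1 by simp
  qed
  ultimately show ?thesis
    by (auto simp: partial_order_on_def preorder_on_def occ_order_def)
qed

lemma occ_top_eq:
  assumes "\<tau> \<in> permutations_of_set {1..n}" "set occ \<subseteq> set \<tau>"
  shows "occ_top occ \<tau> = (\<tau>, {i. i < length \<tau> \<and> \<tau> ! i \<in> set occ})"
proof -
  have "filter (\<lambda>x. x \<in> set occ \<union> complement_letters occ \<tau>) \<tau> = \<tau>"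
    by (rule filter_True) (auto simp: complement_letters_def)
  then show ?thesis
    using standard_form_id[OF assms(1)] by (simp add: occ_plus_def marked_form_def)
qed

end

theory Submission
  imports Defs
begin

text \<open>To a letter \<open>x\<close> outside the occurrence attach the label (number of letters of the
  occurrence to its left, number of letters of the occurrence below it). Two such letters have
  equal labels iff they lie in one region and no letter of the occurrence lies between them in
  value, so separatedness means that this labelling is injective. The set of labels of \<open>S\<close>
  can be read off the marked standard form of \<open>occ + S\<close>, whereas letters with equal labels give
  the same one-letter extension of the occurrence; hence separatedness amounts to injectivity of
  \<open>S \<mapsto> occ + S\<close>. Injectivity gives a Boolean algebra at once. Conversely, adding
  the letters one at a time yields a chain with \<open>n - k + 1\<close> elements, so a Boolean occurrence
  poset has at least \<open>2 ^ (n - k)\<close> elements, which forces injectivity.\<close>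

section \<open>The Moebius function of a finite Boolean poset\<close>

lemma sum_minus_one_power_card_Pow:
  assumes "finite S" "S \<noteq> {}"
  shows "(\<Sum>T\<in>Pow S. (- 1) ^ card T) = (0 :: 'a :: comm_ring_1)"
proof -
  \<comment> \<open>Expanding a product of vanishing factors yields the alternating sum over
    subsets.\<close>
  have "(\<Prod>x\<in>S. (- 1) + (1 :: 'a)) = (\<Sum>T\<in>Pow S. (\<Prod>x\<in>T. - 1) * (\<Prod>x\<in>S - T. 1))"
    using assms(1) by (rule prod_add)
  moreover have "(0 :: 'a) ^ card S = 0"
    using assms by (simp add: card_gt_0_iff zero_power)
  ultimately show ?thesis by simp
qed

text \<open>By induction on proper subsets, the recursion runs over the images of the proper subsets
  of \<open>S\<close>. The alternating sum over all subsets vanishes, so negating it without its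
  term for \<open>S\<close> leaves exactly that term.\<close>

lemma moebius_boolean:
  assumes fin: "finite A" and po: "partial_order_on A r"
    and F: "bij_betw F (Pow C) A" and C: "finite C"
    and ord: "\<And>S T. S \<subseteq> C \<Longrightarrow> T \<subseteq> C \<Longrightarrow> (F S, F T) \<in> r \<longleftrightarrow> S \<subseteq> T"
    and "S \<subseteq> C"
  shows "moebius A r (F {}) (F S) = (- 1) ^ card S"
proof -
  have inj: "inj_on F (Pow C)" and A: "A = F ` Pow C"
    using F by (auto simp: bij_betw_def)
  have "finite S" using C \<open>S \<subseteq> C\<close> by (rule rev_finite_subset)
  then show ?thesis using \<open>S \<subseteq> C\<close>
  proof (induction S rule: finite_psubset_induct)
    case (psubset S)
    show ?case
    proof (cases "S = {}")
      case True
      then show ?thesis using fin po ord by (simp add: moebius.simps[of A r "F {}"])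
    next
      case False
      then have ne: "F {} \<noteq> F S" using inj psubset.prems by (auto dest: inj_onD)
      have below: "{x \<in> A. (F {}, x) \<in> r \<and> (x, F S) \<in> r \<and> x \<noteq> F S} = F ` (Pow S - {S})"
        using inj psubset.prems ord by (auto simp: A inj_on_eq_iff)
      have inj': "inj_on F (Pow S - {S})"
        by (rule inj_on_subset[OF inj]) (use psubset.prems in auto)
      have "moebius A r (F {}) (F S) = - (\<Sum>T\<in>Pow S - {S}. moebius A r (F {}) (F T))"
        using fin po ord psubset.prems ne
        by (simp add: moebius.simps[of A r "F {}" "F S"] below sum.reindex[OF inj'])
      also have "\<dots> = - (\<Sum>T\<in>Pow S - {S}. (- 1) ^ card T)"
        using psubset by (intro arg_cong[of _ _ uminus] sum.cong) auto
      also have "\<dots> = (- 1) ^ card S"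
        using sum_minus_one_power_card_Pow[OF psubset.hyps(1) False, where 'a = int]
          sum.remove[of "Pow S" S "\<lambda>T. (- 1 :: int) ^ card T"] psubset.hyps(1) by simp
      finally show ?thesis .
    qed
  qed
qed

section \<open>Boolean occurrence posets and injectivity of \<open>occ_plus\<close>\<close>

lemma length_occ_plus:
  assumes "distinct \<tau>" "set occ \<subseteq> set \<tau>" "S \<subseteq> complement_letters occ \<tau>"
  shows "length (fst (occ_plus occ \<tau> S)) = card (set occ) + card S"
proof -
  have "length (fst (occ_plus occ \<tau> S)) = card (set (filter (\<lambda>x. x \<in> set occ \<union> S) \<tau>))"
    unfolding distinct_card[OF distinct_filter[OF assms(1)]]
    by (simp add: occ_plus_def marked_form_def)
  also have "set (filter (\<lambda>x. x \<in> set occ \<union> S) \<tau>) = set occ \<union> S"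
    using assms by (auto simp: complement_letters_def)
  also have "card \<dots> = card (set occ) + card S"
    by (rule card_Un_disjoint)
       (use assms in \<open>auto simp: complement_letters_def intro: finite_subset\<close>)
  finally show ?thesis .
qed

text \<open>\<open>occ_order_iff\<close> only supplies some nested pair of sets with the given
  images; injectivity identifies that pair with \<open>S\<close> and \<open>T\<close>.\<close>

lemma occ_order_occ_plus_iff:
  assumes "distinct \<tau>" "set occ \<subseteq> set \<tau>"
    and inj: "inj_on (occ_plus occ \<tau>) (Pow (complement_letters occ \<tau>))"
    and "S \<subseteq> complement_letters occ \<tau>" "T \<subseteq> complement_letters occ \<tau>"
  shows "(occ_plus occ \<tau> S, occ_plus occ \<tau> T) \<in> occ_order occ \<tau> \<longleftrightarrow> S \<subseteq> T"
proof
  assume "(occ_plus occ \<tau> S, occ_plus occ \<tau> T) \<in> occ_order occ \<tau>"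
  then obtain S' T' where "S' \<subseteq> T'" "T' \<subseteq> complement_letters occ \<tau>"
    "occ_plus occ \<tau> S = occ_plus occ \<tau> S'" "occ_plus occ \<tau> T = occ_plus occ \<tau> T'"
    unfolding occ_order_iff[OF assms(1,2)] by blast
  moreover from this have "S = S'" "T = T'"
    using assms(4,5) inj by (simp_all add: inj_on_eq_iff)
  ultimately show "S \<subseteq> T" by simp
next
  assume "S \<subseteq> T"
  then show "(occ_plus occ \<tau> S, occ_plus occ \<tau> T) \<in> occ_order occ \<tau>"
    unfolding occ_order_iff[OF assms(1,2)] using assms(5) by blast
qed

lemma boolean_algebra_occ_poset_iff_inj:
  assumes "distinct \<tau>" "set occ \<subseteq> set \<tau>"
  shows "boolean_algebra_on (occ_poset occ \<tau>) (occ_order occ \<tau>) \<longleftrightarrow>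
    inj_on (occ_plus occ \<tau>) (Pow (complement_letters occ \<tau>))"
    (is "_ \<longleftrightarrow> inj_on ?F (Pow ?C)")
proof
  assume inj: "inj_on ?F (Pow ?C)"
  then have bij: "bij_betw (inv_into (Pow ?C) ?F) (occ_poset occ \<tau>) (Pow ?C)"
    unfolding occ_poset_def by (intro bij_betw_inv_into inj_on_imp_bij_betw)
  have "(x, y) \<in> occ_order occ \<tau> \<longleftrightarrow> inv_into (Pow ?C) ?F x \<subseteq> inv_into (Pow ?C) ?F y"
    if "x \<in> occ_poset occ \<tau>" "y \<in> occ_poset occ \<tau>" for x y
    using that occ_order_occ_plus_iff[OF assms inj] inj by (auto simp: occ_poset_def)
  moreover have "finite ?C" by (simp add: complement_letters_def)
  ultimately show "boolean_algebra_on (occ_poset occ \<tau>) (occ_order occ \<tau>)"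
    unfolding boolean_algebra_on_def using bij by blast
next
  assume "boolean_algebra_on (occ_poset occ \<tau>) (occ_order occ \<tau>)"
  then obtain B :: "nat set" and f where B: "finite B"
    and f: "bij_betw f (occ_poset occ \<tau>) (Pow B)"
    and ord: "\<And>x y. x \<in> occ_poset occ \<tau> \<Longrightarrow> y \<in> occ_poset occ \<tau> \<Longrightarrow>
      (x, y) \<in> occ_order occ \<tau> \<longleftrightarrow> f x \<subseteq> f y"
    unfolding boolean_algebra_on_def by blast
  have finC: "finite ?C" by (simp add: complement_letters_def)
  have P: "?F S \<in> occ_poset occ \<tau>" if "S \<subseteq> ?C" for S
    using that by (auto simp: occ_poset_def)
  have fB: "f (?F S) \<subseteq> B" if "S \<subseteq> ?C" for S
    using f P[OF that] by (auto simp: bij_betw_def)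
  \<comment> \<open>Each added letter strictly enlarges the set assigned by \<open>f\<close>: order
    preservation gives the inclusion, and different word lengths rule out equality.\<close>
  have "card S \<le> card (f (?F S))" if "finite S" "S \<subseteq> ?C" for S
    using that
  proof (induction S)
    case empty
    then show ?case by simp
  next
    case (insert x S)
    have "(?F S, ?F (insert x S)) \<in> occ_order occ \<tau>"
      unfolding occ_order_iff[OF assms] using insert.prems by blast
    then have "f (?F S) \<subseteq> f (?F (insert x S))"
      using ord P insert.prems by simp
    moreover have "length (fst (?F S)) \<noteq> length (fst (?F (insert x S)))"
      using length_occ_plus[OF assms] insert by simp
    then have "f (?F S) \<noteq> f (?F (insert x S))"
      using f P insert.prems by (metis bij_betw_def inj_on_eq_iff insert_subset)
    ultimately have "card (f (?F S)) < card (f (?F (insert x S)))"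
      using B fB insert.prems by (metis finite_subset psubsetI psubset_card_mono)
    then show ?case using insert by simp
  qed
  from this[of ?C] have "card ?C \<le> card B"
    using finC fB[of ?C] B by (meson card_mono order.trans order.refl)
  \<comment> \<open>\<open>Pow B\<close> is equinumerous with the image of \<open>?F\<close> on
    \<open>Pow ?C\<close>, so this image is at least as large as its finite domain.\<close>
  then have "card (Pow ?C) \<le> card (Pow B)"
    using finC B by (simp add: card_Pow)
  also have "\<dots> = card (?F ` Pow ?C)"
    using f by (metis bij_betw_same_card occ_poset_def)
  finally have "card (?F ` Pow ?C) = card (Pow ?C)"
    using finC by (simp add: card_image_le order.antisym)
  then show "inj_on ?F (Pow ?C)"
    using finC by (simp add: eq_card_imp_inj_on)
qed

section \<open>Labels of the unmarked letters, and separatedness as injectivity of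
  \<open>occ_plus\<close>\<close>

lemma sublist_in_region:
  assumes "sublist r0 \<tau>" "set r0 \<inter> set occ = {}"
  obtains r where "is_region occ \<tau> r" "sublist r0 r"
proof -
  let ?P = "\<lambda>r. sublist r \<tau> \<and> set r \<inter> set occ = {} \<and> sublist r0 r"
  \<comment> \<open>A longest candidate is a region: any admissible extension of it is again a
    candidate, hence no longer, hence equal.\<close>
  have "\<exists>r. ?P r \<and> (\<forall>r'. ?P r' \<longrightarrow> length r' \<le> length r)"
    by (rule ex_has_greatest_nat[where k = r0 and b = "Suc (length \<tau>)"])
       (use assms in \<open>auto simp: less_Suc_eq_le dest: sublist_length_le\<close>)
  then obtain r where r: "?P r" and max: "\<And>r'. ?P r' \<Longrightarrow> length r' \<le> length r"
    by blast
  have "r' = r" if "sublist r' \<tau>" "set r' \<inter> set occ = {}" "sublist r r'" for r'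
  proof -
    have "length r' \<le> length r"
      using max that r by (meson sublist_order.order_trans)
    with that(3) show ?thesis by (auto simp: sublist_def)
  qed
  with r have "is_region occ \<tau> r" by (auto simp: is_region_def)
  with r show thesis using that by blast
qed

text \<open>In the plot of \<open>\<tau>\<close>, the positions and values of the occurrence cut out
  a grid; the label names the column and row of the cell containing \<open>x\<close>.\<close>

definition letter_cell :: "nat list \<Rightarrow> nat list \<Rightarrow> nat \<Rightarrow> nat \<times> nat" where
  "letter_cell occ \<tau> x =
     (length (filter (\<lambda>z. z \<in> set occ) (takeWhile (\<lambda>z. z \<noteq> x) \<tau>)),
      card {c \<in> set occ. c < x})"

text \<open>The labels are computed from the marked word alone, without reference to
  \<open>occ\<close> or \<open>\<tau>\<close>, so equal poset elements have equal label
  sets.\<close>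

definition unmarked_cells :: "nat list \<times> nat set \<Rightarrow> (nat \<times> nat) set" where
  "unmarked_cells \<pi> =
     (\<lambda>i. (card {j \<in> snd \<pi>. j < i}, card {j \<in> snd \<pi>. fst \<pi> ! j < fst \<pi> ! i})) `
       ({..<length (fst \<pi>)} - snd \<pi>)"

lemma takeWhile_neq_append:
  "x \<notin> set as \<Longrightarrow> takeWhile (\<lambda>z. z \<noteq> x) (as @ x # bs) = as"
  by (subst takeWhile_append2) auto

text \<open>A label only counts letters of the occurrence. Deleting other unmarked letters keeps
  these counts, and standardizing preserves comparisons.\<close>

lemma unmarked_cells_occ_plus:
  assumes "distinct \<tau>" "set occ \<subseteq> set \<tau>" "S \<subseteq> complement_letters occ \<tau>"
  shows "unmarked_cells (occ_plus occ \<tau> S) = letter_cell occ \<tau> ` S"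
proof -
  define w where "w = filter (\<lambda>x. x \<in> set occ \<union> S) \<tau>"
  define M where "M = {i. i < length w \<and> w ! i \<in> set occ}"
  have dw: "distinct w" using assms(1) by (simp add: w_def)
  have sw: "set w = set occ \<union> S" using assms by (auto simp: w_def complement_letters_def)
  have disj: "set occ \<inter> S = {}" using assms(3) by (auto simp: complement_letters_def)
  have cell: "(card {j \<in> M. j < i}, card {j \<in> M. standard_form w ! j < standard_form w ! i})
      = letter_cell occ \<tau> (w ! i)" if i: "i < length w" and "i \<notin> M" for i
  proof -
    have xt: "w ! i \<in> set \<tau>" using nth_mem[OF i] by (simp add: w_def)
    then obtain as bs where \<tau>: "\<tau> = as @ w ! i # bs" and x: "w ! i \<notin> set as"
      by (metis split_list_first)
    let ?as = "filter (\<lambda>x. x \<in> set occ \<union> S) as"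
    have xw: "w ! i \<in> set occ \<union> S" using i sw nth_mem by blast
    have w_eq: "w = ?as @ w ! i # filter (\<lambda>x. x \<in> set occ \<union> S) bs"
      using arg_cong[OF \<tau>, of "filter (\<lambda>x. x \<in> set occ \<union> S)"] xw by (simp add: w_def)
    then have "length ?as < length w"
      by (metis length_append length_Cons less_add_same_cancel1 zero_less_Suc)
    moreover have "w ! length ?as = w ! i" by (subst w_eq) (rule nth_append_length)
    moreover have w_as: "w ! j = ?as ! j" if "j < length ?as" for j
      by (subst w_eq) (use that in \<open>simp only: nth_append if_True\<close>)
    \<comment> \<open>Filtering \<open>\<tau>\<close> around the letter \<open>w ! i\<close> puts it
      right after \<open>?as\<close>; as letters are distinct, this determines its index.\<close>
    ultimately have i_as: "i = length ?as" using dw i by (simp add: nth_eq_iff_index_eq)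
    have "{j \<in> M. j < i} = {j. j < length ?as \<and> ?as ! j \<in> set occ}"
      using i w_as by (auto simp: M_def i_as)
    then have "card {j \<in> M. j < i} = length (filter (\<lambda>x. x \<in> set occ) ?as)"
      by (simp only: length_filter_conv_card)
    also have "filter (\<lambda>x. x \<in> set occ) ?as = filter (\<lambda>x. x \<in> set occ) as"
      by (auto intro!: filter_cong)
    also have "as = takeWhile (\<lambda>z. z \<noteq> w ! i) \<tau>"
      using takeWhile_neq_append[OF x, of bs] \<tau> by simp
    finally have 1: "card {j \<in> M. j < i}
        = length (filter (\<lambda>x. x \<in> set occ) (takeWhile (\<lambda>z. z \<noteq> w ! i) \<tau>))" .
    have "{j \<in> M. standard_form w ! j < standard_form w ! i} = {j \<in> M. w ! j < w ! i}"
      using order_isomorphic_standard_form[of w] i by (auto simp: M_def order_isomorphic_def)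
    \<comment> \<open>Indexing matches marked positions with letters of the occurrence, turning a
      count of positions into a count of letters.\<close>
    moreover have "(!) w ` {j \<in> M. w ! j < w ! i} = {c \<in> set occ. c < w ! i}"
    proof (intro equalityI subsetI)
      fix c assume c: "c \<in> {c \<in> set occ. c < w ! i}"
      then obtain j where "j < length w" "w ! j = c"
        using sw by (metis (no_types, lifting) UnI1 in_set_conv_nth mem_Collect_eq)
      with c show "c \<in> (!) w ` {j \<in> M. w ! j < w ! i}" by (auto simp: M_def)
    qed (auto simp: M_def)
    moreover have "inj_on ((!) w) {j \<in> M. w ! j < w ! i}"
      using dw by (auto simp: inj_on_def M_def nth_eq_iff_index_eq)
    ultimately have 2: "card {j \<in> M. standard_form w ! j < standard_form w ! i}
        = card {c \<in> set occ. c < w ! i}"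
      using card_image by metis
    show ?thesis by (simp add: letter_cell_def 1 2)
  qed
  have "occ_plus occ \<tau> S = (standard_form w, M)"
    by (simp only: occ_plus_def marked_form_def w_def M_def)
  then have "unmarked_cells (occ_plus occ \<tau> S)
      = (\<lambda>i. letter_cell occ \<tau> (w ! i)) ` ({..<length w} - M)"
    unfolding unmarked_cells_def using cell by (intro image_cong) simp_all
  also have "\<dots> = letter_cell occ \<tau> ` ((!) w ` ({..<length w} - M))"
    by (simp add: image_image)
  also have "(!) w ` ({..<length w} - M) = S"
  proof (intro equalityI subsetI)
    fix x assume x: "x \<in> S"
    then obtain j where "j < length w" "w ! j = x" using sw by (metis UnI2 in_set_conv_nth)
    then show "x \<in> (!) w ` ({..<length w} - M)" using x disj by (auto simp: M_def)
  next
    fix x assume "x \<in> (!) w ` ({..<length w} - M)"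
    then obtain i where "i < length w" "w ! i \<notin> set occ" "x = w ! i" by (auto simp: M_def)
    then show "x \<in> S" using sw nth_mem by blast
  qed
  finally show ?thesis .
qed

text \<open>Equal first coordinates would leave no letter of the occurrence between the two
  positions, placing both letters in one region. Separatedness then provides a letter between them
  in value, so the second coordinates differ.\<close>

lemma letter_cell_neq:
  assumes sep: "separated occ \<tau>" and dist: "distinct \<tau>"
    and \<tau>: "\<tau> = as @ x # bs @ y # cs" and x: "x \<notin> set occ" and y: "y \<notin> set occ"
  shows "letter_cell occ \<tau> x \<noteq> letter_cell occ \<tau> y"
proof
  assume eq: "letter_cell occ \<tau> x = letter_cell occ \<tau> y"
  have "takeWhile (\<lambda>z. z \<noteq> x) \<tau> = as" "takeWhile (\<lambda>z. z \<noteq> y) \<tau> = as @ x # bs"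
    using dist takeWhile_neq_append[of x as] takeWhile_neq_append[of y "as @ x # bs"]
    by (auto simp: \<tau>)
  \<comment> \<open>The prefixes before \<open>x\<close> and before \<open>y\<close> contain equally
    many letters of the occurrence, and \<open>x\<close> is not one of them.\<close>
  then have "filter (\<lambda>z. z \<in> set occ) bs = []"
    using eq x by (simp add: letter_cell_def)
  then have "set (x # bs @ [y]) \<inter> set occ = {}"
    using x y by (auto simp: filter_empty_conv)
  moreover have "sublist (x # bs @ [y]) \<tau>"
    unfolding sublist_def by (rule exI[of _ as], rule exI[of _ cs]) (simp add: \<tau>)
  ultimately obtain r where r: "is_region occ \<tau> r" "sublist (x # bs @ [y]) r"
    using sublist_in_region by blast
  then have "x \<in> set r" "y \<in> set r" using set_mono_sublist by fastforce+
  moreover have "x \<noteq> y" using dist by (auto simp: \<tau>)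
  \<comment> \<open>The letter \<open>x\<close> comes first in position, but either of the two may
    be the larger in value.\<close>
  ultimately have "\<exists>c\<in>set occ. x < c \<and> c < y \<or> y < c \<and> c < x"
    using sep r(1) unfolding separated_def by (metis nat_neq_iff)
  then obtain c where c: "c \<in> set occ" "x < c \<and> c < y \<or> y < c \<and> c < x" by blast
  have less: "card {c \<in> set occ. c < a} < card {c \<in> set occ. c < b}"
    if "a < c" "c < b" for a b
  proof (rule psubset_card_mono)
    have "c \<in> {c \<in> set occ. c < b}" "c \<notin> {c \<in> set occ. c < a}" using that c(1) by auto
    moreover have "{c \<in> set occ. c < a} \<subseteq> {c \<in> set occ. c < b}" using that by auto
    ultimately show "{c \<in> set occ. c < a} \<subset> {c \<in> set occ. c < b}" by blast
  qed simp
  show False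
    using c(2) less[of x y] less[of y x] eq by (auto simp: letter_cell_def)
qed

lemma inj_on_letter_cell:
  assumes "separated occ \<tau>" "distinct \<tau>"
  shows "inj_on (letter_cell occ \<tau>) (complement_letters occ \<tau>)"
proof (rule inj_onI, rule ccontr)
  fix x y
  assume x: "x \<in> complement_letters occ \<tau>" and y: "y \<in> complement_letters occ \<tau>"
    and eq: "letter_cell occ \<tau> x = letter_cell occ \<tau> y" and "x \<noteq> y"
  then obtain as us where \<tau>: "\<tau> = as @ x # us"
    by (auto simp: complement_letters_def dest: split_list)
  then have "y \<in> set as \<or> y \<in> set us"
    using y \<open>x \<noteq> y\<close> by (auto simp: complement_letters_def)
  \<comment> \<open>\<open>letter_cell_neq\<close> takes its letters in order of position, so both
    orders are offered.\<close>
  then have "(\<exists>as bs cs. \<tau> = as @ x # bs @ y # cs) \<or> (\<exists>as bs cs. \<tau> = as @ y # bs @ x # cs)"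
    by (fastforce simp: \<tau> dest: split_list)
  then show False
    using letter_cell_neq[OF assms] x y eq by (metis DiffD2 complement_letters_def)
qed

text \<open>Both letters enter the occurrence at the same place and compare alike with each of its
  letters, so replacing one by the other is an order isomorphism that respects the marks.\<close>

lemma occ_plus_singleton_eq:
  assumes "distinct \<tau>" "set occ \<subseteq> set \<tau>"
    and r: "sublist r \<tau>" "set r \<inter> set occ = {}"
    and xy: "x \<in> set r" "y \<in> set r" "x < y"
    and gap: "\<not> (\<exists>c\<in>set occ. x < c \<and> c < y)"
  shows "occ_plus occ \<tau> {x} = occ_plus occ \<tau> {y}"
proof -
  obtain as bs where \<tau>: "\<tau> = as @ r @ bs" using r(1) by (auto simp: sublist_def)
  let ?o = "filter (\<lambda>z. z \<in> set occ)"
  have flt: "filter (\<lambda>z. z \<in> set occ \<union> {u}) \<tau> = ?o as @ [u] @ ?o bs" if u: "u \<in> set r" for u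
  proof -
    have "filter (\<lambda>z. z \<in> set occ \<union> {u}) vs = ?o vs" if "u \<notin> set vs" for vs
      by (rule filter_cong) (use that in auto)
    moreover have "u \<notin> set as" "u \<notin> set bs" using assms(1) u by (auto simp: \<tau>)
    moreover have "filter (\<lambda>z. z \<in> set occ \<union> {u}) r = [u]"
    proof -
      obtain ps qs where ps: "r = ps @ u # qs" using u by (auto dest: split_list)
      moreover have "u \<notin> set ps" "u \<notin> set qs" using assms(1) by (auto simp: \<tau> ps)
      moreover have "filter (\<lambda>z. z \<in> set occ \<union> {u}) vs = []"
        if "u \<notin> set vs" "set vs \<subseteq> set r" for vs
        using that r(2) by (auto simp: filter_empty_conv)
      ultimately show ?thesis by (simp add: subset_iff)
    qed
    ultimately show ?thesis by (simp add: \<tau>)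
  qed
  \<comment> \<open>This renaming fixes the occurrence and is order preserving on
    \<open>set occ \<union> {x}\<close>, so \<open>marked_form_map\<close> applies.\<close>
  let ?f = "id(x := y)"
  have x: "x \<notin> set occ" and y: "y \<notin> set occ" using r(2) xy by auto
  have mono: "?f u < ?f v \<longleftrightarrow> u < v" if "u \<in> set occ \<union> {x}" "v \<in> set occ \<union> {x}" for u v
  proof -
    have "c < x \<longleftrightarrow> c < y" "x < c \<longleftrightarrow> y < c" if "c \<in> set occ" for c
      using that gap xy(3) x y by (metis less_trans nat_neq_iff)+
    with that show ?thesis by auto
  qed
  have map_o: "map ?f (?o vs) = ?o vs" for vs
    by (rule map_idI) (use x in auto)
  have "?f ` set occ = set occ" using x by auto
  moreover have "map ?f (?o as @ [x] @ ?o bs) = ?o as @ [y] @ ?o bs"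
    using map_o by simp
  moreover have "marked_form (map ?f (?o as @ [x] @ ?o bs)) (?f ` set occ)
      = marked_form (?o as @ [x] @ ?o bs) (set occ)"
    by (rule marked_form_map[where A = "set occ \<union> {x}", OF mono]) auto
  ultimately show ?thesis
    by (simp only: occ_plus_def flt[OF xy(1)] flt[OF xy(2)])
qed

text \<open>If the labelling is injective, \<open>S\<close> is recovered from its label set. A pair
  of letters violating separatedness gives two distinct singletons with the same image.\<close>

lemma inj_occ_plus_iff_separated:
  assumes "distinct \<tau>" "set occ \<subseteq> set \<tau>"
  shows "inj_on (occ_plus occ \<tau>) (Pow (complement_letters occ \<tau>)) \<longleftrightarrow> separated occ \<tau>"
proof
  assume sep: "separated occ \<tau>"
  show "inj_on (occ_plus occ \<tau>) (Pow (complement_letters occ \<tau>))"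
  proof (rule inj_onI)
    fix S T assume ST: "S \<in> Pow (complement_letters occ \<tau>)" "T \<in> Pow (complement_letters occ \<tau>)"
      and "occ_plus occ \<tau> S = occ_plus occ \<tau> T"
    then have "letter_cell occ \<tau> ` S = letter_cell occ \<tau> ` T"
      using unmarked_cells_occ_plus[OF assms] by (metis PowD)
    then show "S = T"
      using inj_on_letter_cell[OF sep assms(1)] ST by (simp add: inj_on_image_eq_iff)
  qed
next
  assume inj: "inj_on (occ_plus occ \<tau>) (Pow (complement_letters occ \<tau>))"
  show "separated occ \<tau>"
    unfolding separated_def
  proof (intro allI impI ballI, rule ccontr)
    fix r x y
    assume r: "is_region occ \<tau> r" and xy: "x \<in> set r" "y \<in> set r" "x < y"
      and gap: "\<not> (\<exists>c\<in>set occ. x < c \<and> c < y)"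
    from r have r': "sublist r \<tau>" "set r \<inter> set occ = {}" by (auto simp: is_region_def)
    have "set r \<subseteq> complement_letters occ \<tau>"
      using r' set_mono_sublist by (fastforce simp: complement_letters_def)
    then have "{x} = {y}"
      using occ_plus_singleton_eq[OF assms r' xy gap] xy by (intro inj_onD[OF inj]) auto
    with xy show False by simp
  qed
qed

theorem theorem4p4:
  fixes k n :: nat and \<sigma> \<tau> occ :: "nat list"
  assumes "\<sigma> \<in> permutations_of_set {1..k}"
    and "\<tau> \<in> permutations_of_set {1..n}"
    and "contained_in \<sigma> \<tau>"
    and "is_occurrence occ \<sigma> \<tau>"
  shows "(boolean_algebra_on (occ_poset occ \<tau>) (occ_order occ \<tau>) \<longleftrightarrow> separated occ \<tau>) \<and>
    (separated occ \<tau> \<longrightarrow>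
      moebius (occ_poset occ \<tau>) (occ_order occ \<tau>) (occ_bot occ \<tau>) (occ_top occ \<tau>)
        = (- 1) ^ (n - k))"
proof -
  let ?C = "complement_letters occ \<tau>"
  have \<tau>: "distinct \<tau>" "set \<tau> = {1..n}" using assms(2) by (auto simp: permutations_of_set_def)
  have subseq: "subseq occ \<tau>" and len: "length occ = length \<sigma>"
    using assms(4) by (auto simp: is_occurrence_def order_isomorphic_def)
  have occ: "set occ \<subseteq> set \<tau>" "distinct occ"
    using subseq \<tau>(1) by (auto simp: subseq_conv_nths dest: in_set_nthsD)
  have "length \<sigma> = k"
    using assms(1) length_finite_permutations_of_set by fastforce
  then have card: "card ?C = n - k"
    using \<tau> occ len by (simp add: complement_letters_def card_Diff_subset distinct_card)
  have "moebius (occ_poset occ \<tau>) (occ_order occ \<tau>) (occ_bot occ \<tau>) (occ_top occ \<tau>)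
      = (- 1) ^ (n - k)" if "separated occ \<tau>"
  proof -
    have inj: "inj_on (occ_plus occ \<tau>) (Pow ?C)"
      using that inj_occ_plus_iff_separated[OF \<tau>(1) occ(1)] by simp
    then have "bij_betw (occ_plus occ \<tau>) (Pow ?C) (occ_poset occ \<tau>)"
      by (simp add: bij_betw_def occ_poset_def)
    \<comment> \<open>Bottom and top are the images of \<open>{}\<close> and \<open>?C\<close>, so
      the exponent is \<open>card ?C\<close>.\<close>
    from moebius_boolean[OF finite_occ_poset partial_order_occ_order[OF \<tau>(1) occ(1)] this _
        occ_order_occ_plus_iff[OF \<tau>(1) occ(1) inj], of ?C]
    show ?thesis by (simp add: card) (simp add: complement_letters_def)
  qed
  then show ?thesis
    using boolean_algebra_occ_poset_iff_inj[OF \<tau>(1) occ(1)]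
      inj_occ_plus_iff_separated[OF \<tau>(1) occ(1)] by simp
qed

end
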